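(* Let $\langle X,\mathcal{K},R\rangle$ be a normal mS-space. Then $R=R_{T_R}$ and $m_R=\Box_{T_R}$ (as maps on $S(X)$).
   Context: **S-spaces.** Let $X$ be a set and $\mathcal{K}\subseteq\mathcal{P}(X)$, regarded as a subbase of a topology on $X$. Put $S(X)=\{U^c: U\in\mathcal{K}\}$ and $\mathcal{C}_{\mathcal{K}}(X)=\{\bigcap\mathcal{A}:\mathcal{A}\subseteq S(X)\}$ (with $\bigcap\emptyset=X$). For $Y\subseteq X$, a family $\mathcal{J}\subseteq S(X)$ is a $Y$-family if for all $A,B\in\mathcal{J}$ there are $H\in S(X)$, $C\in\mathcal{J}$ with $Y\subseteq H$, $A\cap H\subseteq C$ and $B\cap H\subseteq C$. $\langle X,\mathcal{K}\rangle$ is an S-space if: (S1) the topology is $T_0$ and $X=\bigcup\mathcal{K}$; (S2) $\mathcal{K}$ is a subbase of compact open sets, closed under finite unions, and $\emptyset\in\mathcal{K}$; (S3) if $x\in U\cap V$ with $U,V\in\mathcal{K}$, there are $W,D\in\mathcal{K}$ with $x\notin W$, $x\in D$, $D\subseteq(U\cap V)\cup W$; (S4) if $Y\in\mathcal{C}_{\mathcal{K}}(X)$ and $\mathcal{J}\subseteq S(X)$ is a $Y$-family with $Y\cap A^c\neq\emptyset$ for all $A\in\mathcal{J}$, then $Y\cap\bigcap\{A^c:A\in\mathcal{J}\}\neq\emptyset$. Then $\mathbf{S}(X)=\langle S(X),\cap,X\rangle$ is a meet-semilattice with greatest element. Put $\mathrm{cl}_{\mathcal{K}}(y)=\bigcap\{U\in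 S(X):y\in U\}$, $y\sqsupseteq x$ iff $x\in\mathrm{cl}_{\mathcal{K}}(y)$, and $(x]=\{y\in X:y\sqsupseteq x\}$. **mS-spaces.** $\mathcal{Z}(X)$ is the set of all $Z=\bigcap\mathcal{L}$ with $\mathcal{L}\subseteq\mathcal{K}$ non-empty and dually directed under $\subseteq$. For $U\in S(X)$, $L_U=\{Z\in\mathcal{Z}(X):Z\cap U\neq\emptyset\}$. An mS-space is $\langle X,\mathcal{K},R\rangle$ with $\langle X,\mathcal{K}\rangle$ an S-space and $R\subseteq X\times\mathcal{Z}(X)$ such that, with $m_R(U)=\{x\in X:R(x)\subseteq L_U\}$: (m1) $m_R(U)\in S(X)$ for all $U\in S(X)$; (m2) $R(x)=\bigcap\{L_U:U\in S(X),\ x\in m_R(U)\}$ for all $x\in X$ (intersection taken in $\mathcal{Z}(X)$). It is normal if: (N1) for every $x\in X$ and $Z\in R(x)$ there is $z\in Z$ with $(z]\in R(x)$; (N2) $\emptyset\notin R(x)$ for every $x\in X$. **Constructions.** For a semilattice $\mathbf{A}$, $\mathcal{X}(\mathbf{A})$ is the set of irreducible filters (proper filters $F$ such that $F=F_1\cap F_2$ with $F_1,F_2$ filters implies $F=F_1$ or $F=F_2$), $\beta_{\mathbf{A}}(a)=\{P\in\mathcal{X}(\mathbf{A}):a\in P\}$, $\mathcal{K}_{\mathbf{A}}=\{\beta_{\mathbf{A}}(a)^c:a\in A\}$; $\langle\mathcal{X}(\mathbf{A}),\mathcal{K}_{\mathbf{A}}\rangle$ is an S-space. For a monotone $m:A\to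 A$: $(P,Z)\in R_m\iff m^{-1}[P]\cap I_{\mathbf{A}}(Z)=\emptyset$ for $P\in\mathcal{X}(\mathbf{A})$, $Z\in\mathcal{Z}(\mathcal{X}(\mathbf{A}))$, where $I_{\mathbf{A}}(Z)=\{a\in A:\beta_{\mathbf{A}}(a)\cap Z=\emptyset\}$; and $(P,Q)\in N_m\iff m^{-1}[P]\subseteq Q$ for $P,Q\in\mathcal{X}(\mathbf{A})$. $H_X:X\to\mathcal{X}(\mathbf{S}(X))$ is the homeomorphism $H_X(x)=\{A\in S(X):x\in A\}$. For a normal mS-space $\langle X,\mathcal{K},R\rangle$, with $m_R:S(X)\to S(X)$ given by $m_R(U)=\{x\in X:R(x)\subseteq L_U\}$, the relation $T_R\subseteq X\times X$ is defined by $(x,y)\in T_R\iff(H_X(x),H_X(y))\in N_{m_R}$. For a relation $T\subseteq X\times X$, $T(x)=\{y:(x,y)\in T\}$ and $\Box_T(U)=\{x:T(x)\subseteq U\}$; when $\Box_T$ maps $S(X)$ to $S(X)$, the multirelation $R_T\subseteq X\times\mathcal{Z}(X)$ is defined by $(x,Z)\in R_T\iff(H_X(x),H_X[Z])\in R_{\Box_T}$. *)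

theory Defs
  imports "HOL-Analysis.Analysis" "HOL-Algebra.Group"
begin

section \<open>Semilattices with greatest element\<close>

text \<open>A meet-semilattice with greatest element is an idempotent commutative monoid:
  the multiplication is the meet, the unit is the greatest element, and the order is
  \<open>a \<le> b \<longleftrightarrow> a \<otimes> b = a\<close>.\<close>

locale meet_semilattice_top = comm_monoid A for A (structure) +
  assumes meet_idem: "a \<in> carrier A \<Longrightarrow> a \<otimes> a = a"

definition sl_filter :: "('a, 'b) monoid_scheme \<Rightarrow> 'a set \<Rightarrow> bool" where
  "sl_filter A F \<longleftrightarrow> F \<subseteq> carrier A \<and> \<one>\<^bsub>A\<^esub> \<in> F \<and>
     (\<forall>a\<in>F. \<forall>b\<in>F. a \<otimes>\<^bsub>A\<^esub> b \<in> F) \<and>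
     (\<forall>a\<in>F. \<forall>b\<in>carrier A. a \<otimes>\<^bsub>A\<^esub> b = a \<longrightarrow> b \<in> F)"

definition irr_filters :: "('a, 'b) monoid_scheme \<Rightarrow> 'a set set" where
  "irr_filters A = {F. sl_filter A F \<and> F \<noteq> carrier A \<and>
     (\<forall>F1 F2. sl_filter A F1 \<longrightarrow> sl_filter A F2 \<longrightarrow> F = F1 \<inter> F2 \<longrightarrow> F = F1 \<or> F = F2)}"

definition beta :: "('a, 'b) monoid_scheme \<Rightarrow> 'a \<Rightarrow> 'a set set" where
  "beta A a = {P \<in> irr_filters A. a \<in> P}"

definition irr_subbase :: "('a, 'b) monoid_scheme \<Rightarrow> 'a set set set" where
  "irr_subbase A = {irr_filters A - beta A a | a. a \<in> carrier A}"

section \<open>S-spaces\<close>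

definition Ssets :: "'a set \<Rightarrow> 'a set set \<Rightarrow> 'a set set" where
  "Ssets X K = {X - U | U. U \<in> K}"

text \<open>Intersecting with \<open>X\<close> implements the convention that the empty intersection is \<open>X\<close>.\<close>

definition Csets :: "'a set \<Rightarrow> 'a set set \<Rightarrow> 'a set set" where
  "Csets X K = {X \<inter> \<Inter>\<A> | \<A>. \<A> \<subseteq> Ssets X K}"

text \<open>A family is understood to be non-empty: in an S-space \<open>{} \<in> Csets X K\<close>, as the
  intersection of all of \<open>Ssets X K\<close>, so S4 for the empty family would be contradictory.\<close>

definition Y_family :: "'a set \<Rightarrow> 'a set set \<Rightarrow> 'a set \<Rightarrow> 'a set set \<Rightarrow> bool" where
  "Y_family X K Y \<J> \<longleftrightarrow> \<J> \<subseteq> Ssets X K \<and> \<J> \<noteq> {} \<and>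
     (\<forall>A\<in>\<J>. \<forall>B\<in>\<J>. \<exists>H\<in>Ssets X K. \<exists>C\<in>\<J>. Y \<subseteq> H \<and> A \<inter> H \<subseteq> C \<and> B \<inter> H \<subseteq> C)"

locale S_space =
  fixes X :: "'a set" and K :: "'a set set"
  assumes subsets: "K \<subseteq> Pow X"
    and S1_T0: "t0_space (topology_generated_by K)"
    and S1_cover: "X = \<Union>K"
    and S2_compact: "\<And>U. U \<in> K \<Longrightarrow> compactin (topology_generated_by K) U"
    and S2_Un: "\<And>U V. U \<in> K \<Longrightarrow> V \<in> K \<Longrightarrow> U \<union> V \<in> K"
    and S2_empty: "{} \<in> K"
    and S3: "\<And>x U V. U \<in> K \<Longrightarrow> V \<in> K \<Longrightarrow> x \<in> U \<inter> V \<Longrightarrow>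
               \<exists>W\<in>K. \<exists>D\<in>K. x \<notin> W \<and> x \<in> D \<and> D \<subseteq> (U \<inter> V) \<union> W"
    and S4: "\<And>Y \<J>. Y \<in> Csets X K \<Longrightarrow> Y_family X K Y \<J> \<Longrightarrow>
               (\<And>A. A \<in> \<J> \<Longrightarrow> Y \<inter> (X - A) \<noteq> {}) \<Longrightarrow> Y \<inter> \<Inter>{X - A | A. A \<in> \<J>} \<noteq> {}"

definition S_semilattice :: "'a set \<Rightarrow> 'a set set \<Rightarrow> 'a set monoid" where
  "S_semilattice X K = \<lparr>carrier = Ssets X K, mult = (\<inter>), one = X\<rparr>"

lemma (in S_space) meet_semilattice_top_S_semilattice:
  "meet_semilattice_top (S_semilattice X K)"
proof unfold_locales
  fix A B assume "A \<in> carrier (S_semilattice X K)" "B \<in> carrier (S_semilattice X K)"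
  then obtain U V where "U \<in> K" "V \<in> K" "A = X - U" "B = X - V"
    by (auto simp: S_semilattice_def Ssets_def)
  moreover have "(X - U) \<inter> (X - V) = X - (U \<union> V)"
    by blast
  ultimately show "A \<otimes>\<^bsub>S_semilattice X K\<^esub> B \<in> carrier (S_semilattice X K)"
    using S2_Un[of U V] by (auto simp: S_semilattice_def Ssets_def)
next
  show "\<one>\<^bsub>S_semilattice X K\<^esub> \<in> carrier (S_semilattice X K)"
    using S2_empty by (force simp: S_semilattice_def Ssets_def)
qed (auto simp: S_semilattice_def Ssets_def)

definition cl :: "'a set \<Rightarrow> 'a set set \<Rightarrow> 'a \<Rightarrow> 'a set" where
  "cl X K y = X \<inter> \<Inter>{U \<in> Ssets X K. y \<in> U}"

definition spec_ge :: "'a set \<Rightarrow> 'a set set \<Rightarrow> 'a \<Rightarrow> 'a \<Rightarrow> bool" where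
  "spec_ge X K y x \<longleftrightarrow> x \<in> cl X K y"

definition principal :: "'a set \<Rightarrow> 'a set set \<Rightarrow> 'a \<Rightarrow> 'a set" where
  "principal X K x = {y \<in> X. spec_ge X K y x}"

definition H_map :: "'a set \<Rightarrow> 'a set set \<Rightarrow> 'a \<Rightarrow> 'a set set" where
  "H_map X K x = {A \<in> Ssets X K. x \<in> A}"

section \<open>Normal mS-spaces\<close>

definition dually_directed :: "'a set set \<Rightarrow> bool" where
  "dually_directed L \<longleftrightarrow> (\<forall>U\<in>L. \<forall>V\<in>L. \<exists>W\<in>L. W \<subseteq> U \<and> W \<subseteq> V)"

definition Zsets :: "'a set set \<Rightarrow> 'a set set" where
  "Zsets K = {\<Inter>L | L. L \<subseteq> K \<and> L \<noteq> {} \<and> dually_directed L}"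

definition Lset :: "'a set set \<Rightarrow> 'a set \<Rightarrow> 'a set set" where
  "Lset K U = {Z \<in> Zsets K. Z \<inter> U \<noteq> {}}"

definition m_op :: "'a set \<Rightarrow> 'a set set \<Rightarrow> ('a \<times> 'a set) set \<Rightarrow> 'a set \<Rightarrow> 'a set" where
  "m_op X K R U = {x \<in> X. R `` {x} \<subseteq> Lset K U}"

locale mS_space = S_space X K for X :: "'a set" and K :: "'a set set" +
  fixes R :: "('a \<times> 'a set) set"
  assumes multirelation: "R \<subseteq> X \<times> Zsets K"
    and m1: "\<And>U. U \<in> Ssets X K \<Longrightarrow> m_op X K R U \<in> Ssets X K"
    and m2: "\<And>x. x \<in> X \<Longrightarrow>
               R `` {x} = Zsets K \<inter> \<Inter>{Lset K U | U. U \<in> Ssets X K \<and> x \<in> m_op X K R U}"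

locale normal_mS_space = mS_space X K R
  for X :: "'a set" and K :: "'a set set" and R :: "('a \<times> 'a set) set" +
  assumes N1: "\<And>x Z. x \<in> X \<Longrightarrow> Z \<in> R `` {x} \<Longrightarrow> \<exists>z\<in>Z. principal X K z \<in> R `` {x}"
    and N2: "\<And>x. x \<in> X \<Longrightarrow> {} \<notin> R `` {x}"

section \<open>Relations induced by a map on a semilattice\<close>

definition preim :: "('a, 'b) monoid_scheme \<Rightarrow> ('a \<Rightarrow> 'a) \<Rightarrow> 'a set \<Rightarrow> 'a set" where
  "preim A m P = {a \<in> carrier A. m a \<in> P}"

definition I_set :: "('a, 'b) monoid_scheme \<Rightarrow> 'a set set \<Rightarrow> 'a set" where
  "I_set A Z = {a \<in> carrier A. beta A a \<inter> Z = {}}"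

definition R_map :: "('a, 'b) monoid_scheme \<Rightarrow> ('a \<Rightarrow> 'a) \<Rightarrow> ('a set \<times> 'a set set) set" where
  "R_map A m = {(P, Z). P \<in> irr_filters A \<and> Z \<in> Zsets (irr_subbase A) \<and>
     preim A m P \<inter> I_set A Z = {}}"

definition N_map :: "('a, 'b) monoid_scheme \<Rightarrow> ('a \<Rightarrow> 'a) \<Rightarrow> ('a set \<times> 'a set) set" where
  "N_map A m = {(P, Q). P \<in> irr_filters A \<and> Q \<in> irr_filters A \<and> preim A m P \<subseteq> Q}"

section \<open>Passing between multirelations and relations\<close>

definition T_of :: "'a set \<Rightarrow> 'a set set \<Rightarrow> ('a \<times> 'a set) set \<Rightarrow> ('a \<times> 'a) set" where
  "T_of X K R = {(x, y). x \<in> X \<and> y \<in> X \<and>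
     (H_map X K x, H_map X K y) \<in> N_map (S_semilattice X K) (m_op X K R)}"

definition box_op :: "'a set \<Rightarrow> ('a \<times> 'a) set \<Rightarrow> 'a set \<Rightarrow> 'a set" where
  "box_op X T U = {x \<in> X. T `` {x} \<subseteq> U}"

text \<open>Meaningful only when \<open>box_op X T\<close> maps \<open>Ssets X K\<close> into itself.\<close>

definition R_of :: "'a set \<Rightarrow> 'a set set \<Rightarrow> ('a \<times> 'a) set \<Rightarrow> ('a \<times> 'a set) set" where
  "R_of X K T = {(x, Z). x \<in> X \<and> Z \<in> Zsets K \<and>
     (H_map X K x, H_map X K ` Z) \<in> R_map (S_semilattice X K) (box_op X T)}"

end

theory Submission
  imports Defs
begin

text \<open>The map \<open>x \<mapsto> H_map X K x\<close> is a bijection of an S-space onto the irreducible filters of its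
  semilattice (S3 makes \<open>H_map X K x\<close> irreducible, T0 gives injectivity, and compactness
  together with S4 gives surjectivity), and it carries each \<open>U \<in> K\<close> to a member of the subbase.
  Hence \<open>(x, y) \<in> T_of X K R\<close> says that \<open>y \<in> A\<close> whenever \<open>x \<in> m_op X K R A\<close>, and membership of
  \<open>(x, Z)\<close> in \<open>R_of\<close> says that \<open>Z\<close> meets every \<open>A\<close> with \<open>x \<in> box_op X T A\<close>. Once both operators
  agree, the latter is m2. For the nontrivial inclusion between the operators, N1 gives \<open>z \<in> Z\<close>
  with \<open>principal X K z \<in> R `` {x}\<close>; every \<open>A\<close> meeting \<open>principal X K z\<close> contains \<open>z\<close>, so
  \<open>(x, z) \<in> T_of X K R\<close>.\<close>

text \<open>By induction on how an open set is generated; this turns the T0 axiom into separation of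
  points by members of \<open>K\<close>.\<close>

lemma topology_generated_by_indistinct:
  assumes "openin (topology_generated_by K) U" and "\<And>V. V \<in> K \<Longrightarrow> x \<in> V \<longleftrightarrow> y \<in> V"
  shows "x \<in> U \<longleftrightarrow> y \<in> U"
proof -
  have "generate_topology_on K U"
    using assms(1) by (simp add: openin_topology_generated_by_iff)
  then show ?thesis
    by induction (use assms(2) in auto)
qed

section \<open>The semilattice of subbasic closed sets and its filters\<close>

lemma carrier_S_semilattice [simp]: "carrier (S_semilattice X K) = Ssets X K"
  and mult_S_semilattice [simp]: "A \<otimes>\<^bsub>S_semilattice X K\<^esub> B = A \<inter> B"
  and one_S_semilattice [simp]: "\<one>\<^bsub>S_semilattice X K\<^esub> = X"
  by (simp_all add: S_semilattice_def)

context S_space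
begin

lemma Ssets_I: "U \<in> K \<Longrightarrow> X - U \<in> Ssets X K"
  by (auto simp: Ssets_def)

lemma Ssets_Compl: "A \<in> Ssets X K \<Longrightarrow> X - A \<in> K"
  using subsets by (auto simp: Ssets_def double_diff)

lemma Ssets_top: "X \<in> Ssets X K"
  using Ssets_I[OF S2_empty] by simp

lemma Ssets_Int: "A \<in> Ssets X K \<Longrightarrow> B \<in> Ssets X K \<Longrightarrow> A \<inter> B \<in> Ssets X K"
  using meet_semilattice_top_S_semilattice
    monoid.m_closed[of "S_semilattice X K" A B]
  by (simp add: meet_semilattice_top_def comm_monoid_def)

lemma Zsets_subset: "Z \<in> Zsets K \<Longrightarrow> Z \<subseteq> X"
  using subsets unfolding Zsets_def by blast

lemma sl_filter_iff:
  "sl_filter (S_semilattice X K) F \<longleftrightarrow> F \<subseteq> Ssets X K \<and> X \<in> F \<and>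
     (\<forall>A\<in>F. \<forall>B\<in>F. A \<inter> B \<in> F) \<and> (\<forall>A\<in>F. \<forall>B\<in>Ssets X K. A \<subseteq> B \<longrightarrow> B \<in> F)"
  by (simp add: sl_filter_def flip: inf.absorb_iff1)

section \<open>Points as irreducible filters\<close>

lemma H_map_irreducible:
  assumes x: "x \<in> X"
  shows "H_map X K x \<in> irr_filters (S_semilattice X K)"
proof -
  have filter: "sl_filter (S_semilattice X K) (H_map X K x)"
    using x Ssets_top Ssets_Int by (auto simp: sl_filter_iff H_map_def)
  obtain U where "U \<in> K" "x \<in> U"
    using x S1_cover by blast
  then have "X - U \<in> Ssets X K" "X - U \<notin> H_map X K x"
    by (auto simp: Ssets_I H_map_def)
  then have proper: "H_map X K x \<noteq> Ssets X K"
    by blast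
  have "H_map X K x = F1 \<or> H_map X K x = F2"
    if F1: "sl_filter (S_semilattice X K) F1" and F2: "sl_filter (S_semilattice X K) F2"
      and eq: "H_map X K x = F1 \<inter> F2" for F1 F2
  proof (rule ccontr)
    assume "\<not> ?thesis"
    then obtain A B where A: "A \<in> F1" "A \<notin> H_map X K x" and B: "B \<in> F2" "B \<notin> H_map X K x"
      using eq by blast
    then have "A \<in> Ssets X K" "B \<in> Ssets X K" "x \<notin> A" "x \<notin> B"
      using F1 F2 by (auto simp: sl_filter_iff H_map_def)
    \<comment> \<open>S3 applies because both complements contain \<open>x\<close>. The set
      \<open>X - D\<close> will lie above \<open>A \<inter> (X - W)\<close> and
      \<open>B \<inter> (X - W)\<close>, hence in both filters, although it omits
      \<open>x\<close>.\<close>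
    then obtain W D where W: "W \<in> K" "x \<notin> W" and D: "D \<in> K" "x \<in> D"
      and sub: "D \<subseteq> ((X - A) \<inter> (X - B)) \<union> W"
      using S3[of "X - A" "X - B" x] Ssets_Compl x by blast
    have W': "X - W \<in> H_map X K x"
      using W x by (simp add: H_map_def Ssets_I)
    have "A \<inter> (X - W) \<in> F1" "B \<inter> (X - W) \<in> F2"
      using A B W' F1 F2 eq by (simp_all add: sl_filter_iff)
    moreover have "A \<inter> (X - W) \<subseteq> X - D" "B \<inter> (X - W) \<subseteq> X - D"
      using sub by blast+
    ultimately have "X - D \<in> F1 \<inter> F2"
      using F1 F2 Ssets_I[OF D(1)] unfolding sl_filter_iff by blast
    then show False
      using D eq by (auto simp: H_map_def)
  qed
  then show ?thesis
    using filter proper by (simp add: irr_filters_def)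
qed

lemma inj_on_H_map: "inj_on (H_map X K) X"
proof (rule inj_onI, rule ccontr)
  fix x y assume xy: "x \<in> X" "y \<in> X" "H_map X K x = H_map X K y" "x \<noteq> y"
  have same: "x \<in> V \<longleftrightarrow> y \<in> V" if "V \<in> K" for V
  proof -
    have "X - V \<in> H_map X K x \<longleftrightarrow> X - V \<in> H_map X K y"
      by (simp only: xy(3))
    then show ?thesis
      using xy(1,2) Ssets_I[OF that] by (simp add: H_map_def)
  qed
  obtain U where "openin (topology_generated_by K) U" "x \<notin> U \<longleftrightarrow> y \<in> U"
    using S1_T0 xy(1,2,4) S1_cover unfolding t0_space_def topology_generated_by_topspace
    by blast
  then show False
    using topology_generated_by_indistinct[of K U x y] same by blast
qed

section \<open>Every irreducible filter comes from a point\<close>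

lemma sl_filter_finite_Inter:
  assumes F: "sl_filter (S_semilattice X K) F" and "finite \<B>" "\<B> \<subseteq> F"
  shows "X \<inter> \<Inter>\<B> \<in> F"
  using assms(2,3)
proof induction
  case empty
  then show ?case
    using F by (simp add: sl_filter_iff)
next
  case (insert B \<B>)
  then have "B \<inter> (X \<inter> \<Inter>\<B>) \<in> F"
    using F by (simp add: sl_filter_iff)
  then show ?case
    by (simp add: Int_left_commute)
qed

text \<open>Compactness of \<open>X - A\<close>: the complements of the members of \<open>F\<close>
  cover it, so finitely many do, and the meet of the corresponding members lies in \<open>F\<close>
  and below \<open>A\<close>. The factor \<open>X\<close> makes the meet of the empty subfamily the
  greatest element.\<close>

lemma sl_filter_Inter_subset:
  assumes F: "sl_filter (S_semilattice X K) F" and A: "A \<in> Ssets X K"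
    and sub: "X \<inter> \<Inter>F \<subseteq> A"
  shows "A \<in> F"
proof -
  have FS: "F \<subseteq> Ssets X K"
    using F by (simp add: sl_filter_iff)
  have "\<forall>U \<in> (-) X ` F. openin (topology_generated_by K) U"
    using FS Ssets_Compl by (auto intro: topology_generated_by_Basis)
  moreover have "X - A \<subseteq> \<Union>((-) X ` F)"
    using sub by blast
  ultimately obtain \<F> where "finite \<F>" "\<F> \<subseteq> (-) X ` F" and cover: "X - A \<subseteq> \<Union>\<F>"
    using S2_compact[OF Ssets_Compl[OF A]] unfolding compactin_def by meson
  then obtain \<B> where \<B>: "finite \<B>" "\<B> \<subseteq> F" "\<F> = (-) X ` \<B>"
    by (meson finite_subset_image)
  then have "X \<inter> \<Inter>\<B> \<subseteq> A"
    using cover by blast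
  then show ?thesis
    using sl_filter_finite_Inter[OF F \<B>(1,2)] F A unfolding sl_filter_iff by blast
qed

text \<open>\<open>G\<close> is the filter generated by \<open>F\<close> and \<open>A\<close>, in
  explicit form.\<close>

lemma sl_filter_adjoin:
  assumes F: "sl_filter (S_semilattice X K) F" and A: "A \<in> Ssets X K"
  defines "G \<equiv> {C \<in> Ssets X K. \<exists>H\<in>F. A \<inter> H \<subseteq> C}"
  shows "sl_filter (S_semilattice X K) G" and "F \<subseteq> G" and "A \<in> G"
proof -
  have G_Int: "C \<inter> D \<in> G" if CD: "C \<in> G" "D \<in> G" for C D
  proof -
    obtain H H' where H: "H \<in> F" "H' \<in> F" "A \<inter> H \<subseteq> C" "A \<inter> H' \<subseteq> D"
      using CD unfolding G_def by blast
    then have "H \<inter> H' \<in> F" "A \<inter> (H \<inter> H') \<subseteq> C \<inter> D"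
      using F unfolding sl_filter_iff by blast+
    then show ?thesis
      using CD Ssets_Int unfolding G_def by blast
  qed
  show FG: "F \<subseteq> G"
    using F unfolding G_def sl_filter_iff by blast
  show "A \<in> G"
    using F A unfolding G_def sl_filter_iff by blast
  have "D \<in> G" if "C \<in> G" "D \<in> Ssets X K" "C \<subseteq> D" for C D
    using that unfolding G_def by blast
  moreover have "G \<subseteq> Ssets X K" "X \<in> G"
    using F FG unfolding G_def sl_filter_iff by auto
  ultimately show "sl_filter (S_semilattice X K) G"
    using G_Int unfolding sl_filter_iff by blast
qed

text \<open>For \<open>A\<close> and \<open>B\<close> outside \<open>P\<close>, the filters
  generated by \<open>P\<close> with \<open>A\<close> and by \<open>P\<close> with \<open>B\<close>
  both extend \<open>P\<close> properly. By irreducibility their intersection is not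
  \<open>P\<close>, which supplies the bound \<open>C\<close> outside \<open>P\<close>.\<close>

lemma irr_filter_Y_family:
  assumes P: "P \<in> irr_filters (S_semilattice X K)"
  shows "Y_family X K (X \<inter> \<Inter>P) (Ssets X K - P)"
proof -
  have F: "sl_filter (S_semilattice X K) P" and ne: "P \<noteq> Ssets X K"
    and irr: "\<And>F1 F2. sl_filter (S_semilattice X K) F1 \<Longrightarrow> sl_filter (S_semilattice X K) F2
       \<Longrightarrow> P = F1 \<inter> F2 \<Longrightarrow> P = F1 \<or> P = F2"
    using P by (auto simp: irr_filters_def)
  have "\<exists>H\<in>Ssets X K. \<exists>C\<in>Ssets X K - P. X \<inter> \<Inter>P \<subseteq> H \<and> A \<inter> H \<subseteq> C \<and> B \<inter> H \<subseteq> C"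
    if A: "A \<in> Ssets X K - P" and B: "B \<in> Ssets X K - P" for A B
  proof -
    define G where "G D = {C \<in> Ssets X K. \<exists>H\<in>P. D \<inter> H \<subseteq> C}" for D
    have G: "sl_filter (S_semilattice X K) (G D)" "P \<subseteq> G D" "D \<in> G D" if "D \<in> Ssets X K" for D
      using sl_filter_adjoin[OF F that] by (simp_all add: G_def)
    have "P \<noteq> G A \<inter> G B"
      using irr[of "G A" "G B"] G[of A] G[of B] A B by blast
    then obtain C where C: "C \<in> G A" "C \<in> G B" "C \<notin> P"
      using G(2)[of A] G(2)[of B] A B by blast
    then obtain H H' where H: "H \<in> P" "H' \<in> P" "A \<inter> H \<subseteq> C" "B \<inter> H' \<subseteq> C"
      unfolding G_def by blast
    \<comment> \<open>A \<open>Y_family\<close> asks for one set serving both \<open>A\<close> and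
      \<open>B\<close>; being in \<open>P\<close>, this meet contains
      \<open>X \<inter> \<Inter>P\<close>.\<close>
    then have "H \<inter> H' \<in> P" "H \<inter> H' \<in> Ssets X K"
      using F unfolding sl_filter_iff by blast+
    moreover have "C \<in> Ssets X K - P"
      using C by (simp add: G_def)
    moreover have "X \<inter> \<Inter>P \<subseteq> H \<inter> H'" "A \<inter> (H \<inter> H') \<subseteq> C" "B \<inter> (H \<inter> H') \<subseteq> C"
      using H by blast+
    ultimately show ?thesis
      by blast
  qed
  \<comment> \<open>Non-emptiness of the family is properness of \<open>P\<close>.\<close>
  moreover have "Ssets X K - P \<noteq> {}"
    using F ne unfolding sl_filter_iff by blast
  ultimately show ?thesis
    unfolding Y_family_def by blast
qed

text \<open>S4 with \<open>X \<inter> \<Inter>P\<close> as \<open>Y\<close> and the complement of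
  \<open>P\<close> as the family gives a point lying in all members of \<open>P\<close> and in no
  other subbasic closed set.\<close>

lemma H_map_surj:
  assumes P: "P \<in> irr_filters (S_semilattice X K)"
  obtains x where "x \<in> X" "P = H_map X K x"
proof -
  have F: "sl_filter (S_semilattice X K) P"
    using P by (simp add: irr_filters_def)
  have PS: "P \<subseteq> Ssets X K"
    using F by (simp add: sl_filter_iff)
  have "(X \<inter> \<Inter>P) \<inter> \<Inter>{X - A | A. A \<in> Ssets X K - P} \<noteq> {}"
  proof (rule S4)
    show "X \<inter> \<Inter>P \<in> Csets X K"
      using PS unfolding Csets_def by blast
    show "Y_family X K (X \<inter> \<Inter>P) (Ssets X K - P)"
      by (rule irr_filter_Y_family[OF P])
    \<comment> \<open>Otherwise \<open>A\<close> would contain the intersection of \<open>P\<close>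
      and so belong to \<open>P\<close>.\<close>
    show "(X \<inter> \<Inter>P) \<inter> (X - A) \<noteq> {}" if "A \<in> Ssets X K - P" for A
      using sl_filter_Inter_subset[OF F, of A] that by blast
  qed
  then obtain x where x: "x \<in> (X \<inter> \<Inter>P) \<inter> \<Inter>{X - A | A. A \<in> Ssets X K - P}"
    unfolding ex_in_conv[symmetric] ..
  have "A \<in> P \<longleftrightarrow> x \<in> A" if "A \<in> Ssets X K" for A
  proof
    show "x \<in> A" if "A \<in> P"
      using x that by simp
    show "A \<in> P" if "x \<in> A"
    proof (rule ccontr)
      assume "A \<notin> P"
      then have "X - A \<in> {X - A | A. A \<in> Ssets X K - P}"
        using \<open>A \<in> Ssets X K\<close> by auto
      then have "x \<in> X - A"
        using x unfolding Int_iff Inter_iff by blast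
      then show False
        using that by simp
    qed
  qed
  then have "P = H_map X K x"
    using PS by (auto simp: H_map_def)
  then show thesis
    using x by (intro that) simp_all
qed

section \<open>Transport of sets and multirelations along \<open>H_map\<close>\<close>

lemma H_map_image_subbase:
  assumes U: "U \<in> K"
  shows "H_map X K ` U = irr_filters (S_semilattice X K) - beta (S_semilattice X K) (X - U)"
proof -
  have UX: "U \<subseteq> X"
    using U subsets by blast
  have H: "X - U \<in> H_map X K x \<longleftrightarrow> x \<notin> U" if "x \<in> X" for x
    using that Ssets_I[OF U] by (simp add: H_map_def)
  show ?thesis
  proof
    show "H_map X K ` U \<subseteq> irr_filters (S_semilattice X K) - beta (S_semilattice X K) (X - U)"
      using UX H H_map_irreducible by (auto simp: beta_def)
    show "irr_filters (S_semilattice X K) - beta (S_semilattice X K) (X - U) \<subseteq> H_map X K ` U"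
    proof
      fix P assume P: "P \<in> irr_filters (S_semilattice X K) - beta (S_semilattice X K) (X - U)"
      then obtain x where "x \<in> X" "P = H_map X K x"
        using H_map_surj by blast
      with P show "P \<in> H_map X K ` U"
        using H by (auto simp: beta_def)
    qed
  qed
qed

lemma H_map_image_Zsets:
  assumes "Z \<in> Zsets K"
  shows "H_map X K ` Z \<in> Zsets (irr_subbase (S_semilattice X K))"
proof -
  obtain L where L: "Z = \<Inter>L" "L \<subseteq> K" "L \<noteq> {}" "dually_directed L"
    using assms by (auto simp: Zsets_def)
  let ?M = "(`) (H_map X K) ` L"
  have "H_map X K ` Z = \<Inter>?M"
  proof -
    \<comment> \<open>An injective image commutes with intersections only over a non-empty family,
      hence the chosen member.\<close>
    obtain U where "U \<in> L"
      using L by blast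
    moreover have "\<forall>V\<in>L. V \<subseteq> X"
      using L subsets by blast
    ultimately show ?thesis
      using image_INT[OF inj_on_H_map, of L "\<lambda>V. V" U] L(1) by simp
  qed
  moreover have "?M \<subseteq> irr_subbase (S_semilattice X K)"
  proof
    fix V assume "V \<in> ?M"
    then obtain U where "U \<in> K" "V = H_map X K ` U"
      using L by blast
    then show "V \<in> irr_subbase (S_semilattice X K)"
      using H_map_image_subbase Ssets_I by (auto simp: irr_subbase_def)
  qed
  moreover have "?M \<noteq> {}"
    using L by blast
  moreover have "dually_directed ?M"
    using L(4) unfolding dually_directed_def ball_simps bex_simps by (meson image_mono)
  ultimately show ?thesis
    unfolding Zsets_def by blast
qed

lemma beta_Int_H_map_image:
  assumes "A \<in> Ssets X K" and "Z \<subseteq> X"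
  shows "beta (S_semilattice X K) A \<inter> H_map X K ` Z = {} \<longleftrightarrow> A \<inter> Z = {}"
proof -
  have "H_map X K z \<in> beta (S_semilattice X K) A \<longleftrightarrow> z \<in> A" if "z \<in> Z" for z
    using H_map_irreducible[of z] assms that by (auto simp: beta_def H_map_def)
  then show ?thesis
    by blast
qed

text \<open>A filter \<open>H_map X K x\<close> holds only members of \<open>Ssets X K\<close>; by
  \<open>box\<close>, having \<open>box_op X T A\<close> in it then amounts to
  \<open>x \<in> box_op X T A\<close>. The set \<open>I_set\<close> becomes the collection of those
  \<open>A\<close> that miss \<open>Z\<close>.\<close>

lemma R_of_iff:
  assumes box: "\<And>A. A \<in> Ssets X K \<Longrightarrow> box_op X T A \<in> Ssets X K"
  shows "(x, Z) \<in> R_of X K T \<longleftrightarrow> x \<in> X \<and> Z \<in> Zsets K \<and>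
     (\<forall>A\<in>Ssets X K. x \<in> box_op X T A \<longrightarrow> Z \<in> Lset K A)"
proof (cases "x \<in> X \<and> Z \<in> Zsets K")
  case True
  then have "(x, Z) \<in> R_of X K T \<longleftrightarrow>
      preim (S_semilattice X K) (box_op X T) (H_map X K x) \<inter>
      I_set (S_semilattice X K) (H_map X K ` Z) = {}"
    by (simp add: R_of_def R_map_def H_map_irreducible H_map_image_Zsets)
  also have "preim (S_semilattice X K) (box_op X T) (H_map X K x) =
      {A \<in> Ssets X K. x \<in> box_op X T A}"
    using box by (auto simp: preim_def H_map_def)
  also have "I_set (S_semilattice X K) (H_map X K ` Z) = {A \<in> Ssets X K. A \<inter> Z = {}}"
    using beta_Int_H_map_image[OF _ Zsets_subset[of Z]] True by (auto simp: I_set_def)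
  finally show ?thesis
    using True by (auto simp: Lset_def Int_commute)
qed (auto simp: R_of_def)

end

section \<open>The operators and the multirelation of an mS-space\<close>

context mS_space
begin

lemma T_of_iff:
  "(x, y) \<in> T_of X K R \<longleftrightarrow>
     x \<in> X \<and> y \<in> X \<and> (\<forall>A\<in>Ssets X K. x \<in> m_op X K R A \<longrightarrow> y \<in> A)"
proof (cases "x \<in> X \<and> y \<in> X")
  case True
  then have "(x, y) \<in> T_of X K R \<longleftrightarrow>
      {A \<in> Ssets X K. m_op X K R A \<in> H_map X K x} \<subseteq> H_map X K y"
    by (simp add: T_of_def N_map_def preim_def H_map_irreducible)
  then show ?thesis
    using True m1 by (auto simp: H_map_def)
qed (auto simp: T_of_def)

text \<open>Axiom m2 read elementwise, in the shape of \<open>R_of_iff\<close>, so that equal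
  operators give equal multirelations.\<close>

lemma mem_R_iff:
  "(x, Z) \<in> R \<longleftrightarrow> x \<in> X \<and> Z \<in> Zsets K \<and>
     (\<forall>A\<in>Ssets X K. x \<in> m_op X K R A \<longrightarrow> Z \<in> Lset K A)"
proof (cases "x \<in> X")
  case True
  then show ?thesis
    using m2[OF True] by (auto simp: set_eq_iff)
qed (use multirelation in auto)

end

lemma (in normal_mS_space) m_op_eq_box_op:
  assumes U: "U \<in> Ssets X K"
  shows "m_op X K R U = box_op X (T_of X K R) U"
proof
  show "m_op X K R U \<subseteq> box_op X (T_of X K R) U"
    using U by (auto simp: box_op_def T_of_iff m_op_def)
  show "box_op X (T_of X K R) U \<subseteq> m_op X K R U"
  proof
    fix x assume x: "x \<in> box_op X (T_of X K R) U"
    have "Z \<in> Lset K U" if Z: "(x, Z) \<in> R" for Z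
    proof -
      have xX: "x \<in> X" and ZZ: "Z \<in> Zsets K"
        using Z multirelation by auto
      obtain z where z: "z \<in> Z" "(x, principal X K z) \<in> R"
        using N1[OF xX] Z by blast
      have "z \<in> A" if "A \<in> Ssets X K" "x \<in> m_op X K R A" for A
      proof -
        have "principal X K z \<inter> A \<noteq> {}"
          using z(2) that by (auto simp: mem_R_iff Lset_def)
        \<comment> \<open>A point \<open>y\<close> of the intersection has \<open>z\<close> in its
          closure, and \<open>cl X K y \<subseteq> A\<close> because
          \<open>y \<in> A\<close>.\<close>
        then show ?thesis
          using that by (auto simp: principal_def spec_ge_def cl_def)
      qed
      then have "(x, z) \<in> T_of X K R"
        using xX z(1) Zsets_subset[OF ZZ] by (auto simp: T_of_iff)
      then have "z \<in> U"
        using x by (auto simp: box_op_def)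
      then show ?thesis
        using z(1) ZZ by (auto simp: Lset_def)
    qed
    then show "x \<in> m_op X K R U"
      using x by (auto simp: m_op_def box_op_def)
  qed
qed

theorem proposition4p2:
  fixes X :: "'a set" and K :: "'a set set" and R :: "('a \<times> 'a set) set"
  assumes "normal_mS_space X K R"
  shows "R = R_of X K (T_of X K R) \<and>
         (\<forall>U \<in> Ssets X K. m_op X K R U = box_op X (T_of X K R) U)"
proof -
  interpret normal_mS_space X K R
    by (rule assms)
  \<comment> \<open>The hypothesis of \<open>R_of_iff\<close>, inherited from m1 through the
    equality of the operators.\<close>
  have "box_op X (T_of X K R) A \<in> Ssets X K" if "A \<in> Ssets X K" for A
    using m1[OF that] m_op_eq_box_op[OF that] by simp
  then have "(x, Z) \<in> R \<longleftrightarrow> (x, Z) \<in> R_of X K (T_of X K R)" for x Z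
    by (simp add: mem_R_iff[of x Z] R_of_iff m_op_eq_box_op)
  then show ?thesis
    using m_op_eq_box_op by auto
qed

end
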